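(* Let $n>1$ be an integer. Each zero-free sequence of length greater than $n/2$ in the cyclic group $\mathbb{Z}_n$ is equivalent to a sequence whose sum of the least positive representatives is less than $n$.
   Context: $\mathbb{Z}_n=\mathbb{Z}/n\mathbb{Z}$ is the additive group of integers modulo $n$. Sequences are finite, and terms may repeat. A sequence in $\mathbb{Z}_n$ is zero-free if no nonempty subsequence of it has sum equal to the zero element of $\mathbb{Z}_n$ (a subsequence is obtained by choosing a set of indices). For sequences $\alpha,\beta$ in $\mathbb{Z}_n$, $\alpha$ is equivalent to $\beta$ if $\beta$ can be obtained from $\alpha$ through multiplication of all terms by an integer $g$ coprime to $n$ and rearrangement of terms. For $a\in\mathbb{Z}_n$, the least positive representative $\overline{a}$ is the unique integer in $\{1,2,\dots,n\}$ belonging to the congruence class $a$ modulo $n$. The sum of the least positive representatives of $\alpha=(a_1,\dots,a_k)$ is $L(\alpha)=\sum_{i=1}^k\overline{a_i}$. *)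

theory Defs
  imports Complex_Main "HOL-Algebra.Elementary_Groups" "HOL-Algebra.FiniteProduct" "HOL-Number_Theory.Cong" "HOL-Library.Multiset"
begin

text \<open>
  The group of integers modulo \<open>n\<close> is \<^const>\<open>integer_mod_group\<close>: its carrier for \<open>n > 0\<close> is
  \<open>{0..<int n}\<close>, each residue class being represented by its least nonnegative member.
  It is written multiplicatively in the library, so its unit is the zero class, a sum of classes
  is a \<^const>\<open>finprod\<close>, and \<open>a [^] g\<close> is the multiple of the class \<open>a\<close> by the integer \<open>g\<close>.
\<close>

definition sequence_in :: "nat \<Rightarrow> int list \<Rightarrow> bool" where
  "sequence_in n \<alpha> \<longleftrightarrow> set \<alpha> \<subseteq> carrier (integer_mod_group n)"

definition zero_free :: "nat \<Rightarrow> int list \<Rightarrow> bool" where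
  "zero_free n \<alpha> \<longleftrightarrow>
     (\<forall>I. I \<subseteq> {..<length \<alpha>} \<longrightarrow> I \<noteq> {} \<longrightarrow>
        finprod (integer_mod_group n) (\<lambda>i. \<alpha> ! i) I \<noteq> \<one>\<^bsub>integer_mod_group n\<^esub>)"

definition equivalent :: "nat \<Rightarrow> int list \<Rightarrow> int list \<Rightarrow> bool" where
  "equivalent n \<alpha> \<beta> \<longleftrightarrow>
     (\<exists>g::int. coprime g (int n) \<and>
        mset \<beta> = mset (map (\<lambda>a. a [^]\<^bsub>integer_mod_group n\<^esub> g) \<alpha>))"

definition least_pos_rep :: "nat \<Rightarrow> int \<Rightarrow> int" where
  "least_pos_rep n a = (THE m. m \<in> {1..int n} \<and> [m = a] (mod int n))"

lemma least_pos_rep_ex1: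
  assumes "n > 0"
  shows "\<exists>!m. m \<in> {1..int n} \<and> [m = a] (mod int n)"
proof (rule ex1I)
  let ?m = "(a - 1) mod int n + 1"
  have "0 \<le> (a - 1) mod int n" "(a - 1) mod int n < int n"
    using assms by simp_all
  moreover have "[?m = a] (mod int n)"
    by (simp add: cong_def mod_add_left_eq)
  ultimately show "?m \<in> {1..int n} \<and> [?m = a] (mod int n)"
    by simp
next
  fix m assume m: "m \<in> {1..int n} \<and> [m = a] (mod int n)"
  then have "[m - 1 = a - 1] (mod int n)"
    by (auto intro: cong_diff)
  with m show "m = (a - 1) mod int n + 1"
    by (auto simp: cong_def)
qed

definition L :: "nat \<Rightarrow> int list \<Rightarrow> int" where
  "L n \<alpha> = (\<Sum>a\<leftarrow>\<alpha>. least_pos_rep n a)"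

end

theory Submission
  imports Defs
begin

text \<open>
  Let \<open>S\<close> be the set of subset sums of a zero-free sequence of length \<open>l > n / 2\<close>, the empty
  sum included. As \<open>S\<close> lives in a group of order \<open>n\<close>, it has fewer than \<open>2 * l\<close> elements: on
  average, a term contributes fewer than two sums. This forces the sequence to be, for some class
  \<open>a\<close>, a sequence of positive multiples \<open>x\<^sub>i * a\<close> such that, with \<open>s\<close> the sum of the \<open>x\<^sub>i\<close>, \<open>S\<close>
  consists of the multiples \<open>0 * a, \<dots>, s * a\<close> and these are pairwise distinct
  (\<open>few_subsums_imp_multiples\<close>).

  Given this, \<open>s + 1 \<le> n\<close>, while \<open>s \<ge> l > n / 2\<close>. So \<open>a\<close> has order greater than \<open>n / 2\<close>, that
  is, \<open>a\<close> is a generator. Multiplying by its inverse modulo \<open>n\<close> turns the sequence into the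
  \<open>x\<^sub>i\<close> themselves, whose sum is \<open>s < n\<close>.

  The structure theorem is an induction that peels off a term whose removal loses at least two
  subset sums, for this keeps the number of sums below twice the length. Putting the term
  back lengthens the progression (\<open>multiples_absorb_term\<close>). The peeling stops when the removal
  of any term loses exactly one subset sum, and such a sequence is constant
  (\<open>terms_congruent_if_minimal_growth\<close>).
\<close>

section \<open>Subset sums modulo n\<close>

text \<open>
  The empty sum is included so that adjoining a term to \<open>M\<close> replaces the set of sums by its
  union with a translate of it (\<open>subsums_add_mset\<close>).
\<close>

definition subsums :: "int \<Rightarrow> int multiset \<Rightarrow> int set" where
  "subsums n M = (\<lambda>N. \<Sum>\<^sub># N mod n) ` {N. N \<subseteq># M}"

definition zero_sum_free :: "int \<Rightarrow> int multiset \<Rightarrow> bool" where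
  "zero_sum_free n M \<longleftrightarrow> (\<forall>N. N \<subseteq># M \<longrightarrow> N \<noteq> {#} \<longrightarrow> \<Sum>\<^sub># N mod n \<noteq> 0)"

lemma zero_sum_freeD:
  assumes "zero_sum_free n M" "N \<subseteq># M" "N \<noteq> {#}"
  shows "\<Sum>\<^sub># N mod n \<noteq> 0"
  using assms by (simp add: zero_sum_free_def)

lemma subsums_bounds:
  assumes "n > 0"
  shows "subsums n M \<subseteq> {0..<n}"
  using assms by (auto simp: subsums_def)

lemma finite_subsums:
  assumes "n > 0"
  shows "finite (subsums n M)"
  using subsums_bounds[OF assms] finite_subset by blast

lemma zero_in_subsums: "0 \<in> subsums n M"
  unfolding subsums_def by (rule image_eqI[of _ _ "{#}"]) auto

lemma total_in_subsums: "\<Sum>\<^sub># M mod n \<in> subsums n M"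
  by (auto simp: subsums_def)

lemma subsums_empty: "subsums n {#} = {0}"
  by (auto simp: subsums_def)

lemma subsums_add_mset:
  "subsums n (add_mset u M) = subsums n M \<union> (\<lambda>y. (y + u) mod n) ` subsums n M"
proof (intro equalityI subsetI)
  fix y assume "y \<in> subsums n (add_mset u M)"
  then obtain N where N: "N \<subseteq># add_mset u M" "y = \<Sum>\<^sub># N mod n"
    by (auto simp: subsums_def)
  show "y \<in> subsums n M \<union> (\<lambda>y. (y + u) mod n) ` subsums n M"
  proof (cases "u \<in># N")
    case True
    then obtain N' where N': "N = add_mset u N'" by (metis insert_DiffM)
    with N have "N' \<subseteq># M" by simp
    then have "\<Sum>\<^sub># N' mod n \<in> subsums n M" by (auto simp: subsums_def)
    moreover have "y = (\<Sum>\<^sub># N' mod n + u) mod n"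
      using N N' by (simp add: mod_simps add.commute)
    ultimately show ?thesis by blast
  next
    case False
    with N have "N \<subseteq># M"
      by (metis diff_single_trivial subset_eq_diff_conv add_mset_add_single)
    with N show ?thesis by (auto simp: subsums_def)
  qed
next
  fix y assume "y \<in> subsums n M \<union> (\<lambda>y. (y + u) mod n) ` subsums n M"
  then show "y \<in> subsums n (add_mset u M)"
  proof
    assume "y \<in> subsums n M"
    then obtain N where "N \<subseteq># M" "y = \<Sum>\<^sub># N mod n"
      by (auto simp: subsums_def)
    moreover have "M \<subseteq># add_mset u M" by simp
    ultimately show ?thesis
      unfolding subsums_def by (blast intro: subset_mset.order_trans)
  next
    assume "y \<in> (\<lambda>y. (y + u) mod n) ` subsums n M"
    then obtain N where N: "N \<subseteq># M" "y = (\<Sum>\<^sub># N mod n + u) mod n"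
      by (auto simp: subsums_def)
    then show ?thesis unfolding subsums_def
      by (intro image_eqI[of _ _ "add_mset u N"]) (auto simp: mod_simps add.commute)
  qed
qed

lemma inj_on_translate_mod:
  fixes n u :: int
  shows "inj_on (\<lambda>y. (y + u) mod n) {0..<n}"
proof (rule inj_onI)
  fix x y assume xy: "x \<in> {0..<n}" "y \<in> {0..<n}" "(x + u) mod n = (y + u) mod n"
  then have "(x + u - u) mod n = (y + u - u) mod n"
    by (metis mod_diff_left_eq)
  with xy show "x = y" by simp
qed

lemma card_translate_subsums:
  assumes "n > 0"
  shows "card ((\<lambda>y. (y + u) mod n) ` subsums n M) = card (subsums n M)"
  by (intro card_image inj_on_subset[OF inj_on_translate_mod subsums_bounds[OF assms]])

lemma zero_sum_free_subset:
  assumes "zero_sum_free n M" "N \<subseteq># M"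
  shows "zero_sum_free n N"
  using assms(1) subset_mset.order_trans[OF _ assms(2)] unfolding zero_sum_free_def by simp

lemma zero_sum_free_add_mset_nonzero:
  assumes "zero_sum_free n (add_mset u M)" "y \<in> subsums n M"
  shows "(y + u) mod n \<noteq> 0"
proof -
  from assms obtain N where N: "N \<subseteq># M" "y = \<Sum>\<^sub># N mod n"
    by (auto simp: subsums_def)
  then have "add_mset u N \<subseteq># add_mset u M" by simp
  then have "\<Sum>\<^sub># (add_mset u N) mod n \<noteq> 0"
    by (intro zero_sum_freeD[OF assms(1)]) simp_all
  then show ?thesis using N by (simp add: mod_simps add.commute)
qed

lemma total_notin_subsums:
  assumes "zero_sum_free n (add_mset u M)"
  shows "\<Sum>\<^sub># (add_mset u M) mod n \<notin> subsums n M"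
proof
  assume "\<Sum>\<^sub># (add_mset u M) mod n \<in> subsums n M"
  then obtain N where N: "N \<subseteq># M" "\<Sum>\<^sub># (add_mset u M) mod n = \<Sum>\<^sub># N mod n"
    by (auto simp: subsums_def)
  have M: "M = N + (M - N)" using N by simp
  have "\<Sum>\<^sub># (add_mset u (M - N)) = \<Sum>\<^sub># (add_mset u M) - \<Sum>\<^sub># N"
    by (subst (2) M) simp
  also have "\<dots> mod n = 0"
    using N(2) by (simp only: mod_eq_dvd_iff dvd_imp_mod_0)
  finally have "\<Sum>\<^sub># (add_mset u (M - N)) mod n = 0" .
  moreover have "add_mset u (M - N) \<subseteq># add_mset u M" by simp
  ultimately show False
    using zero_sum_freeD[OF assms, of "add_mset u (M - N)"] by simp
qed

section \<open>Terms that create a single new subset sum\<close>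

text \<open>
  A term of a zero-sum free sequence always creates a new subset sum, namely the total: a subset
  avoiding the term with the same sum would leave a zero-sum complement. If the total is
  the only new sum, then comparing cardinalities identifies the old sums and their translate.
\<close>

lemma subsums_minimal_growth:
  assumes "n > 0" and zf: "zero_sum_free n (add_mset u M)"
    and le: "card (subsums n (add_mset u M)) \<le> card (subsums n M) + 1"
  shows "subsums n M = subsums n (add_mset u M) - {\<Sum>\<^sub># (add_mset u M) mod n}"
    and "(\<lambda>y. (y + u) mod n) ` subsums n M = subsums n (add_mset u M) - {0}"
proof -
  let ?S = "subsums n (add_mset u M)"
  have fin: "finite ?S" by (rule finite_subsums[OF \<open>n > 0\<close>])
  have card: "card (?S - {z}) \<le> card (subsums n M)" if "z \<in> ?S" for z
    using that le fin by simp
  show "subsums n M = ?S - {\<Sum>\<^sub># (add_mset u M) mod n}"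
  proof (rule card_seteq)
    show "subsums n M \<subseteq> ?S - {\<Sum>\<^sub># (add_mset u M) mod n}"
      using total_notin_subsums[OF zf] subsums_add_mset by blast
  qed (use fin card[OF total_in_subsums] in simp_all)
  show "(\<lambda>y. (y + u) mod n) ` subsums n M = ?S - {0}"
  proof (rule card_seteq)
    have "0 \<notin> (\<lambda>y. (y + u) mod n) ` subsums n M"
      using zero_sum_free_add_mset_nonzero[OF zf] by (metis (no_types, lifting) imageE)
    then show "(\<lambda>y. (y + u) mod n) ` subsums n M \<subseteq> ?S - {0}"
      by (simp add: subsums_add_mset subset_Diff_insert)
  qed (use fin card[OF zero_in_subsums] card_translate_subsums[OF \<open>n > 0\<close>] in simp_all)
qed

text \<open>
  Write \<open>S\<close> for the subset sums of \<open>M\<close>. If each term is responsible for only one of them, then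
  translation by any term maps the same set, \<open>S\<close> without the total sum, onto \<open>S\<close> without zero.
  So both sets are invariant under translation by the difference \<open>u - v\<close> of two terms. The first
  one contains zero, hence also \<open>u - v\<close>. If \<open>u - v\<close> were nonzero, it would belong to the second
  one, and with it all its multiples, including zero, which is absurd.
\<close>

lemma terms_congruent_if_minimal_growth:
  assumes "n > 0" and zf: "zero_sum_free n M"
    and le: "\<And>u. u \<in># M \<Longrightarrow> card (subsums n M) \<le> card (subsums n (M - {#u#})) + 1"
    and "u \<in># M" "v \<in># M"
  shows "u mod n = v mod n"
proof (rule ccontr)
  assume neq: "u mod n \<noteq> v mod n"
  let ?A = "subsums n M - {\<Sum>\<^sub># M mod n}" and ?B = "subsums n M - {0}"
  have shift: "(\<lambda>y. (y + w) mod n) ` ?A = ?B" if "w \<in># M" for w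
    using subsums_minimal_growth[of n w "M - {#w#}"] that le[OF that] assms(1) zf by simp
  have step: "(y + (u - v)) mod n \<in> ?B" if "y \<in> ?B" for y
  proof -
    from that shift[OF \<open>v \<in># M\<close>] obtain z where z: "z \<in> ?A" "y = (z + v) mod n" by blast
    have "(y + (u - v)) mod n = (z + v + (u - v)) mod n"
      unfolding z(2) by (rule mod_add_left_eq)
    also have "\<dots> = (z + u) mod n" by simp
    also have "\<dots> \<in> (\<lambda>y. (y + u) mod n) ` ?A" using z(1) by (rule imageI)
    finally show ?thesis unfolding shift[OF \<open>u \<in># M\<close>] .
  qed
  have "0 \<in> ?A"
    using zero_sum_freeD[OF zf subset_mset.order_refl] \<open>u \<in># M\<close> zero_in_subsums[of n M]
    by fastforce
  then have "u mod n \<in> ?B"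
    using shift[OF \<open>u \<in># M\<close>] by force
  then obtain z where z: "z \<in> ?A" "(z + v) mod n = u mod n"
    using shift[OF \<open>v \<in># M\<close>] by (metis (no_types, lifting) imageE)
  have "z mod n = (z + v - v) mod n" by simp
  also have "\<dots> = (u - v) mod n" using z(2) by (metis mod_diff_left_eq)
  finally have "z mod n = (u - v) mod n" .
  moreover have "z mod n = z" using z(1) subsums_bounds[OF \<open>n > 0\<close>] by fastforce
  moreover have "(u - v) mod n \<noteq> 0" using neq by (simp add: mod_eq_dvd_iff mod_eq_0_iff_dvd)
  ultimately have base: "(u - v) mod n \<in> ?B" using z(1) by auto
  have "(int (Suc k) * (u - v)) mod n \<in> ?B" for k
  proof (induction k)
    case 0
    then show ?case using base by simp
  next
    case (Suc k)
    have "int (Suc (Suc k)) * (u - v) = int (Suc k) * (u - v) + (u - v)"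
      by (simp add: algebra_simps)
    with step[OF Suc] show ?case by (simp only: mod_add_left_eq)
  qed
  \<comment> \<open>the multiple by \<open>n\<close>, which is zero\<close>
  from this[of "nat n - 1"] have "(n * (u - v)) mod n \<in> ?B"
    using \<open>n > 0\<close> by simp
  then show False by simp
qed

section \<open>Subset sums that form an arithmetic progression\<close>

text \<open>Two equal multiples would make the multiple by their positive difference vanish.\<close>

lemma inj_on_multiples_mod:
  fixes a n s :: int
  assumes "\<And>t. t \<in> {1..s} \<Longrightarrow> t * a mod n \<noteq> 0"
  shows "inj_on (\<lambda>i. i * a mod n) {0..s}"
proof (rule linorder_inj_onI')
  fix i j assume "i \<in> {0..s}" "j \<in> {0..s}" "i < j"
  then have "(j - i) * a mod n \<noteq> 0" by (intro assms) auto
  then have "j * a mod n \<noteq> i * a mod n"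
    by (simp add: mod_eq_dvd_iff mod_eq_0_iff_dvd left_diff_distrib)
  then show "i * a mod n \<noteq> j * a mod n" by simp
qed

lemma subsums_replicate_mset:
  "subsums n (replicate_mset k a) = (\<lambda>i. i * a mod n) ` {0..int k}"
proof (induction k)
  case 0
  then show ?case by (simp add: subsums_empty)
next
  case (Suc k)
  have "(\<lambda>y. (y + a) mod n) ` (\<lambda>i. i * a mod n) ` {0..int k}
      = (\<lambda>i. i * a mod n) ` (\<lambda>i. i + 1) ` {0..int k}"
    unfolding image_image by (intro image_cong) (simp_all add: mod_simps algebra_simps)
  also have "(\<lambda>i. i + 1) ` {0..int k} = {1..int k + 1}" by simp
  finally have "subsums n (replicate_mset (Suc k) a)
      = (\<lambda>i. i * a mod n) ` ({0..int k} \<union> {1..int k + 1})"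
    by (simp add: subsums_add_mset Suc image_Un)
  also have "{0..int k} \<union> {1..int k + 1} = {0..int (Suc k)}" by auto
  finally show ?case .
qed

text \<open>
  One induction step. If the multiples \<open>0 * a, \<dots>, s * a\<close> are the subset sums of \<open>M\<close> and the
  new term \<open>c\<close> yields fewer than \<open>2 * (s + 1)\<close> sums, then the progression meets its translate
  by \<open>c\<close>, so \<open>c\<close> is \<open>x * a\<close> with \<open>\<bar>x\<bar> \<le> s\<close>. Negative or zero \<open>x\<close> is impossible because
  \<open>c\<close> would cancel against a subset sum of \<open>M\<close>. Hence \<open>1 \<le> x \<le> s\<close>, and the two progressions
  overlap enough to fuse into the longer one. Wrapping around is excluded in the same way: a
  vanishing multiple \<open>t * a\<close> with \<open>t > s\<close> would be a subset sum of \<open>M\<close> plus \<open>c\<close>.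
\<close>

lemma multiples_absorb_term:
  fixes a c s n :: int
  assumes "n > 0" "s \<ge> 0" and zf: "zero_sum_free n (add_mset c M)"
    and S: "subsums n M = (\<lambda>i. i * a mod n) ` {0..s}"
    and inj: "inj_on (\<lambda>i. i * a mod n) {0..s}"
    and less: "int (card (subsums n (add_mset c M))) < 2 * s + 2"
  obtains x where "x \<ge> 1" "c mod n = x * a mod n"
    "subsums n (add_mset c M) = (\<lambda>i. i * a mod n) ` {0..s + x}"
    "inj_on (\<lambda>i. i * a mod n) {0..s + x}"
proof -
  let ?f = "\<lambda>i. i * a mod n" and ?T = "(\<lambda>y. (y + c) mod n) ` subsums n M"
  have card: "int (card (subsums n M)) = s + 1"
    unfolding S using card_image[OF inj] \<open>s \<ge> 0\<close> by simp
  have "subsums n M \<inter> ?T \<noteq> {}"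
  proof
    assume "subsums n M \<inter> ?T = {}"
    then have "card (subsums n (add_mset c M)) = card (subsums n M) + card ?T"
      unfolding subsums_add_mset
      by (intro card_Un_disjoint finite_imageI finite_subsums[OF \<open>n > 0\<close>])
    with card less card_translate_subsums[OF \<open>n > 0\<close>, of c M] show False by simp
  qed
  then obtain y where y: "y \<in> ?f ` {0..s}" "y \<in> (\<lambda>j. (?f j + c) mod n) ` {0..s}"
    unfolding S image_image by blast
  from y(1) obtain i where i: "y = ?f i" "i \<in> {0..s}" by (rule imageE)
  from y(2) obtain j where j: "y = (?f j + c) mod n" "j \<in> {0..s}" by (rule imageE)
  have ij: "i \<in> {0..s}" "j \<in> {0..s}" "?f i = (?f j + c) mod n"
    using i j by auto
  then have "?f i = (j * a + c) mod n" by (simp only: mod_add_left_eq)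
  then have "n dvd i * a - (j * a + c)" by (simp only: mod_eq_dvd_iff)
  then have dvd: "n dvd c - (i - j) * a"
    by (subst dvd_minus_iff[symmetric]) (simp add: algebra_simps)
  define x where "x = i - j"
  have c: "c mod n = x * a mod n" using dvd by (simp add: mod_eq_dvd_iff x_def)
  have nonzero: "(i * a + x * a) mod n \<noteq> 0" if "i \<in> {0..s}" for i
    using zero_sum_free_add_mset_nonzero[OF zf, of "?f i"] that c S
    by (metis imageI mod_add_cong mod_mod_trivial)
  have "x \<ge> 1"
  proof (rule ccontr)
    assume "\<not> x \<ge> 1"
    then have "- x \<in> {0..s}" using ij by (auto simp: x_def)
    from nonzero[OF this] show False by simp
  qed
  have "x \<le> s" using ij by (auto simp: x_def)
  have "?T = (\<lambda>i. ?f (i + x)) ` {0..s}"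
    unfolding S image_image
    by (intro image_cong refl) (metis c distrib_right mod_add_cong mod_mod_trivial)
  also have "\<dots> = ?f ` {x..s + x}"
    unfolding image_image[symmetric, of ?f "\<lambda>i. i + x"] by simp
  finally have "subsums n (add_mset c M) = ?f ` ({0..s} \<union> {x..s + x})"
    unfolding subsums_add_mset S by blast
  also have "{0..s} \<union> {x..s + x} = {0..s + x}" using \<open>x \<le> s\<close> \<open>x \<ge> 1\<close> by auto
  finally have sums: "subsums n (add_mset c M) = ?f ` {0..s + x}" .
  have ne: "t * a mod n \<noteq> 0" if t: "t \<in> {1..s + x}" for t
  proof (cases "t \<le> s")
    case True
    with t inj_onD[OF inj, of t 0] show ?thesis by auto
  next
    case False
    with t \<open>x \<le> s\<close> nonzero[of "t - x"] show ?thesis by (simp add: algebra_simps)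
  qed
  have "inj_on ?f {0..s + x}" by (rule inj_on_multiples_mod[OF ne])
  with that \<open>x \<ge> 1\<close> c sums show ?thesis by blast
qed

lemma size_le_sum_mset:
  assumes "\<And>x. x \<in># X \<Longrightarrow> x \<ge> (1::int)"
  shows "int (size X) \<le> \<Sum>\<^sub># X"
  using assms by (induction X) force+

text \<open>
  The structure theorem behind the result, by induction on the size of \<open>M\<close>. Deleting a term that
  accounts for at least two subset sums preserves the hypothesis, so the induction hypothesis
  makes the other terms multiples of some \<open>a\<close>; their multipliers are positive, so their sum is
  at least \<open>size M - 1\<close>, which is exactly what makes the progression meet its translate.
  If no such term exists, then all terms are equal to some \<open>a\<close>; all multipliers are then \<open>1\<close>, and
  zero-sum freeness keeps the multiples of \<open>a\<close> apart.
\<close>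

lemma few_subsums_imp_multiples:
  assumes "n > 0" "zero_sum_free n M" "card (subsums n M) < 2 * size M"
    and "set_mset M \<subseteq> {0..<n}"
  shows "\<exists>a X. (\<forall>x\<in>#X. x \<ge> 1) \<and> M = image_mset (\<lambda>x. x * a mod n) X \<and>
    subsums n M = (\<lambda>i. i * a mod n) ` {0..\<Sum>\<^sub># X} \<and> inj_on (\<lambda>i. i * a mod n) {0..\<Sum>\<^sub># X}"
  using assms(2-)
proof (induction "size M" arbitrary: M)
  case 0
  then show ?case by simp
next
  case (Suc l)
  show ?case
  proof (cases "\<exists>c\<in>#M. card (subsums n (M - {#c#})) + 2 \<le> card (subsums n M)")
    case True
    then obtain c M' where M: "M = add_mset c M'" and
      le: "card (subsums n M') + 2 \<le> card (subsums n M)"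
      by (metis add_mset_remove_trivial insert_DiffM)
    have size: "size M' = l" using Suc.hyps(2) M by simp
    have "zero_sum_free n M'"
      using zero_sum_free_subset[OF Suc.prems(1)] M by simp
    then obtain a X where X: "\<forall>x\<in>#X. x \<ge> 1" "M' = image_mset (\<lambda>x. x * a mod n) X"
      "subsums n M' = (\<lambda>i. i * a mod n) ` {0..\<Sum>\<^sub># X}" "inj_on (\<lambda>i. i * a mod n) {0..\<Sum>\<^sub># X}"
      using Suc.hyps(1)[of M'] size le Suc.prems M by auto
    have "int l \<le> \<Sum>\<^sub># X" using size_le_sum_mset[of X] X(1,2) size by simp
    moreover from this have "\<Sum>\<^sub># X \<ge> 0" by simp
    ultimately obtain x where x: "x \<ge> 1" "c mod n = x * a mod n"
      "subsums n M = (\<lambda>i. i * a mod n) ` {0..\<Sum>\<^sub># X + x}"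
      "inj_on (\<lambda>i. i * a mod n) {0..\<Sum>\<^sub># X + x}"
      using multiples_absorb_term[of n "\<Sum>\<^sub># X" c M' a] \<open>n > 0\<close> X(3,4) Suc.prems(1,2) Suc.hyps(2)
      unfolding M by auto
    moreover have "c mod n = c" using Suc.prems(3) M by simp
    ultimately show ?thesis
      using X(1,2) M by (intro exI[of _ a] exI[of _ "add_mset x X"]) (simp add: add.commute)
  next
    case False
    then have le: "card (subsums n M) \<le> card (subsums n (M - {#u#})) + 1" if "u \<in># M" for u
      using that by force
    obtain a where a: "a \<in># M" using Suc.hyps(2) by (metis size_eq_Suc_imp_elem)
    have "b = a" if b: "b \<in># M" for b
    proof -
      have "b mod n = a mod n"
        by (rule terms_congruent_if_minimal_growth[OF \<open>n > 0\<close> Suc.prems(1) le b a])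
      moreover have "b mod n = b" "a mod n = a"
        using a b Suc.prems(3) by (auto intro!: mod_pos_pos_trivial)
      ultimately show ?thesis by simp
    qed
    then have M: "M = replicate_mset (Suc l) a"
      using Suc.hyps(2) by (metis set_mset_subset_singletonD singletonI subsetI)
    have ne: "t * a mod n \<noteq> 0" if t: "t \<in> {1..int (Suc l)}" for t
    proof -
      have "replicate_mset (nat t) a \<subseteq># M" "replicate_mset (nat t) a \<noteq> {#}"
        using t by (auto simp: M simp flip: count_le_replicate_mset_subset_eq)
      then have "\<Sum>\<^sub># (replicate_mset (nat t) a) mod n \<noteq> 0"
        by (intro zero_sum_freeD[OF Suc.prems(1)])
      with t show ?thesis by simp
    qed
    have "inj_on (\<lambda>i. i * a mod n) {0..int (Suc l)}"
      by (rule inj_on_multiples_mod[OF ne])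
    moreover have "a mod n = a" using a Suc.prems(3) by auto
    ultimately show ?thesis
      using M subsums_replicate_mset[of n "Suc l" a]
      by (intro exI[of _ a] exI[of _ "replicate_mset (Suc l) 1"]) simp
  qed
qed

section \<open>Sequences in the group of integers modulo n\<close>

lemma finprod_integer_mod_group:
  assumes "n > 0" "finite I" "f ` I \<subseteq> {0..<int n}"
  shows "finprod (integer_mod_group n) f I = (\<Sum>i\<in>I. f i) mod int n"
proof -
  interpret comm_group "integer_mod_group n" by simp
  show ?thesis
    using assms(2,3)
  proof (induction I rule: finite_induct)
    case empty
    then show ?case by simp
  next
    case (insert i I)
    have "finprod (integer_mod_group n) f (insert i I) =
        f i \<otimes>\<^bsub>integer_mod_group n\<^esub> finprod (integer_mod_group n) f I"
      using insert assms(1) by (intro finprod_insert) (auto simp: carrier_integer_mod_group)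
    then show ?case using insert assms(1) by (simp add: mult_integer_mod_group mod_simps)
  qed
qed

lemma zero_free_imp_zero_sum_free:
  assumes "n > 0" "sequence_in n \<alpha>" "zero_free n \<alpha>"
  shows "zero_sum_free (int n) (mset \<alpha>)"
  unfolding zero_sum_free_def
proof (intro allI impI)
  fix N assume N: "N \<subseteq># mset \<alpha>" "N \<noteq> {#}"
  have "image_mset (\<lambda>i. \<alpha> ! i) (mset_set {..<length \<alpha>}) = N + (mset \<alpha> - N)"
    using N(1) by (metis atLeast_upt map_nth mset_map mset_upt atLeast0LessThan subset_mset.add_diff_inverse)
  then obtain B where B: "B \<subseteq># mset_set {..<length \<alpha>}" "N = image_mset (\<lambda>i. \<alpha> ! i) B"
    by (metis image_mset_eq_plusD mset_subset_eq_add_left)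
  define I where "I = set_mset B"
  have "I \<subseteq> {..<length \<alpha>}"
    using set_mset_mono[OF B(1)] by (simp add: I_def)
  \<comment> \<open>a submultiset of the multiset of indices uses no index twice, so it is a set of indices\<close>
  have "count B i \<le> count (mset_set {..<length \<alpha>}) i" for i
    using B(1) by (rule mset_subset_eq_count)
  then have "count B i \<le> 1" for i
    by (metis count_mset_set(1,2,3) le_trans zero_le_one order_refl)
  then have "count B i = count (mset_set I) i" for i
    by (cases "i \<in># B") (auto simp: I_def not_in_iff intro: antisym)
  then have "B = mset_set I" by (rule multiset_eqI)
  with B(2) have "\<Sum>\<^sub># N = (\<Sum>i\<in>I. \<alpha> ! i)" by (simp add: sum_unfold_sum_mset)
  moreover have "finprod (integer_mod_group n) (\<lambda>i. \<alpha> ! i) I = (\<Sum>i\<in>I. \<alpha> ! i) mod int n"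
    using assms(1,2) \<open>I \<subseteq> {..<length \<alpha>}\<close>
    by (intro finprod_integer_mod_group)
       (auto simp: I_def sequence_in_def carrier_integer_mod_group subset_iff)
  moreover have "I \<noteq> {}" using N(2) B(2) by (simp add: I_def)
  ultimately show "\<Sum>\<^sub># N mod int n \<noteq> 0"
    using assms(3) \<open>I \<subseteq> {..<length \<alpha>}\<close> unfolding zero_free_def by auto
qed

lemma least_pos_rep_eq:
  assumes "m \<in> {1..int n}" "[m = a] (mod int n)"
  shows "least_pos_rep n a = m"
proof -
  have "n > 0" using assms(1) by auto
  then show ?thesis
    unfolding least_pos_rep_def using least_pos_rep_ex1[of n a] assms by (intro the1_equality) auto
qed

theorem theorem8:
  fixes n :: nat and \<alpha> :: "int list"
  assumes "n > 1"
    and "sequence_in n \<alpha>"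
    and "zero_free n \<alpha>"
    and "real (length \<alpha>) > real n / 2"
  shows "\<exists>\<beta>. sequence_in n \<beta> \<and> equivalent n \<alpha> \<beta> \<and> L n \<beta> < int n"
proof -
  have n: "int n > 0" using assms(1) by simp
  have range: "set_mset (mset \<alpha>) \<subseteq> {0..<int n}"
    using assms(1,2) by (auto simp: sequence_in_def carrier_integer_mod_group)
  have card_le: "card (subsums (int n) (mset \<alpha>)) \<le> n"
    using card_mono[OF _ subsums_bounds[OF n]] by fastforce
  have long: "n < 2 * length \<alpha>" using assms(4) by linarith
  have "zero_sum_free (int n) (mset \<alpha>)"
    using zero_free_imp_zero_sum_free assms(1-3) by simp
  then obtain a X where X: "\<forall>x\<in>#X. x \<ge> 1" "mset \<alpha> = image_mset (\<lambda>x. x * a mod int n) X"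
    and S: "subsums (int n) (mset \<alpha>) = (\<lambda>i. i * a mod int n) ` {0..\<Sum>\<^sub># X}"
    and inj: "inj_on (\<lambda>i. i * a mod int n) {0..\<Sum>\<^sub># X}"
    using few_subsums_imp_multiples[OF n _ _ range] card_le long by auto
  have "int (length \<alpha>) \<le> \<Sum>\<^sub># X"
    using size_le_sum_mset[of X] X by (metis size_image_mset size_mset)
  with long have s: "int n < 2 * \<Sum>\<^sub># X" by linarith
  have "\<Sum>\<^sub># X < int n"
    using card_le card_image[OF inj] s unfolding S by simp
  have "coprime a (int n)"
  proof (rule ccontr)
    assume "\<not> coprime a (int n)"
    define d where "d = gcd a (int n)"
    \<comment> \<open>\<open>k = n / d \<le> n / 2 < s\<close> annihilates \<open>a\<close>, although \<open>0 * a, \<dots>, s * a\<close> are distinct\<close>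
    obtain k where k: "int n = d * k" by (metis d_def dvd_def gcd_dvd2)
    obtain b where b: "a = d * b" by (metis d_def dvd_def gcd_dvd1)
    have "d \<ge> 0" "d \<noteq> 1" "d \<noteq> 0"
      using \<open>\<not> coprime a (int n)\<close> n by (auto simp: d_def coprime_iff_gcd_eq_1)
    then have "d \<ge> 2" by linarith
    then have "k > 0" using k n by (simp add: zero_less_mult_iff)
    then have "2 * k \<le> int n" using k \<open>d \<ge> 2\<close> by simp
    then have "k \<in> {0..\<Sum>\<^sub># X}" using s \<open>k > 0\<close> by simp
    moreover have "k * a mod int n = 0 * a mod int n"
      by (simp add: k b mod_eq_0_iff_dvd)
    ultimately show False
      using inj_onD[OF inj, of k 0] \<open>k > 0\<close> by simp
  qed
  then obtain g where g: "[a * g = 1] (mod int n)"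
    using cong_solve_coprime_int by blast
  then have "coprime g (int n)"
    by (metis coprime_iff_invertible_int mult.commute)
  define \<beta> where "\<beta> = map (\<lambda>y. y [^]\<^bsub>integer_mod_group n\<^esub> g) \<alpha>"
  have "mset \<beta> = image_mset (\<lambda>x. x mod int n) X"
    unfolding \<beta>_def mset_map X(2) image_mset.compositionality o_def
  proof (rule image_mset_cong)
    fix x
    have "[x * (a * g) = x * 1] (mod int n)" by (intro cong_mult cong_refl g)
    then show "(x * a mod int n) [^]\<^bsub>integer_mod_group n\<^esub> g = x mod int n"
      by (simp add: int_pow_integer_mod_group cong_def mod_simps algebra_simps)
  qed
  moreover have "L n \<beta> = \<Sum>\<^sub># (image_mset (least_pos_rep n) (mset \<beta>))"
    by (simp add: L_def flip: sum_mset_sum_list)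
  ultimately have "L n \<beta> = (\<Sum>x\<in>#X. least_pos_rep n (x mod int n))"
    by (simp add: image_mset.compositionality o_def)
  also have "\<dots> = (\<Sum>x\<in>#X. x)"
  proof (intro arg_cong[of _ _ sum_mset] image_mset_cong least_pos_rep_eq)
    fix x assume x: "x \<in># X"
    then have "\<Sum>\<^sub># X = x + \<Sum>\<^sub># (X - {#x#})" by (metis insert_DiffM sum_mset.add_mset)
    moreover have "int (size (X - {#x#})) \<le> \<Sum>\<^sub># (X - {#x#})"
      using X(1) by (intro size_le_sum_mset) (auto dest: in_diffD)
    ultimately show "x \<in> {1..int n}" using X(1) x \<open>\<Sum>\<^sub># X < int n\<close> by simp
  qed (simp add: cong_def)
  finally have "L n \<beta> < int n" using \<open>\<Sum>\<^sub># X < int n\<close> by simp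
  moreover have "sequence_in n \<beta>"
    using assms(1)
    by (auto simp: sequence_in_def \<beta>_def carrier_integer_mod_group int_pow_integer_mod_group)
  moreover have "equivalent n \<alpha> \<beta>"
    using \<open>coprime g (int n)\<close> by (auto simp: equivalent_def \<beta>_def)
  ultimately show ?thesis by blast
qed

end
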